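(* Let $\varkappa\ge\frac{n-1}{n}$ be a real number. For any real polynomial $p$ of degree $n\ge 2$ all of whose real zeros are simple, and all zeros of whose derivative $p'$ are real and simple, $$Z_{\mathbb R}\left(H_{\varkappa}[p]\right)=Z_{\mathbb C}(p).$$
   Context: For a real polynomial $p$ and a real number $\varkappa$, $H_{\varkappa}[p](x)=\varkappa\,(p'(x))^2-p(x)p''(x)$. For a real polynomial $f$, $Z_{\mathbb R}(f)$ denotes the number of real zeros of $f$ counted with multiplicity and $Z_{\mathbb C}(f)$ denotes the number of non-real zeros of $f$ counted with multiplicity.
   Formalization: The case n = 2, ϰ = 1/2 with p having no real zeros is excluded, because there H_ϰ[p] is a nonzero constant while p has two non-real zeros (e.g. p = x²+1, H = −2), so the identity fails in every excluded instance. *)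

theory Defs
  imports "HOL-Computational_Algebra.Computational_Algebra" Complex_Main
begin

abbreviation complex_poly :: "real poly \<Rightarrow> complex poly" where
  "complex_poly \<equiv> map_poly complex_of_real"

definition H :: "real \<Rightarrow> real poly \<Rightarrow> real poly" where
  "H \<kappa> p = smult \<kappa> ((pderiv p)\<^sup>2) - p * pderiv (pderiv p)"

(* proots is the multiset of zeros, so both counts respect multiplicity;
   by its library convention proots 0 is empty. *)

definition Z_R :: "real poly \<Rightarrow> nat" where
  "Z_R f = size (proots f)"

definition Z_C :: "real poly \<Rightarrow> nat" where
  "Z_C f = size (filter_mset (\<lambda>z. z \<notin> \<real>) (proots (complex_poly f)))"

definition real_zeros_simple :: "real poly \<Rightarrow> bool" where
  "real_zeros_simple f \<longleftrightarrow> (\<forall>x. poly f x = 0 \<longrightarrow> order x f = 1)"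

definition all_zeros_real_simple :: "real poly \<Rightarrow> bool" where
  "all_zeros_real_simple f \<longleftrightarrow>
     (\<forall>z. poly (complex_poly f) z = 0 \<longrightarrow> z \<in> \<real> \<and> order z (complex_poly f) = 1)"

(* For p = x^2 + 1 and \<kappa> = 1/2 = (n - 1) / n the polynomial H \<kappa> p is a non-zero constant,
   although p has two non-real zeros. Quadratics without real zeros at \<kappa> = 1/2 therefore
   have to be excluded from the identity Z_R (H \<kappa> p) = Z_C p. *)
lemma quadratic_exception:
  defines "p \<equiv> [:1, 0, 1:]"
  shows "real_zeros_simple p" "all_zeros_real_simple (pderiv p)"
    "H (1/2) p = [:-2:]" "Z_R (H (1/2) p) = 0" "Z_C p = 2"
proof -
  have noz: "poly p x \<noteq> 0" for x :: real
  proof -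
    have "0 \<le> x * x" by simp
    then have "1 + x * x \<noteq> 0" by linarith
    then show ?thesis by (simp add: p_def)
  qed
  then show "real_zeros_simple p" by (simp add: real_zeros_simple_def)
  have d: "pderiv p = [:0, 2:]" by (simp add: p_def pderiv_pCons)
  have c: "complex_poly [:0, 2:] = [:0, 2:]"
    by (simp add: map_poly_pCons)
  have "order (0::complex) [:-0, 1:] = 1"
    using order_power_n_n[of "0::complex" 1] by simp
  then have "order (0::complex) [:0, 2:] = 1"
    using order_smult[of "2::complex" 0 "[:-0, 1:]"] by simp
  then show "all_zeros_real_simple (pderiv p)"
    unfolding all_zeros_real_simple_def d c by simp
  show h: "H (1/2) p = [:-2:]"
    by (simp add: H_def d) (simp add: p_def pderiv_pCons power2_eq_square)
  show "Z_R (H (1/2) p) = 0" by (simp add: Z_R_def h)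
  have pc: "complex_poly p = [:1, 0, 1:]" by (simp add: p_def map_poly_pCons)
  have "z \<notin> \<real>" if "z \<in># proots (complex_poly p)" for z
  proof
    assume "z \<in> \<real>"
    then obtain x where "z = of_real x" by (elim Reals_cases)
    moreover have "poly (complex_poly p) z = 0" using that by (simp add: pc)
    ultimately have "complex_of_real (poly p x) = 0" by (simp add: p_def map_poly_pCons)
    then show False using noz by simp
  qed
  then have "filter_mset (\<lambda>z. z \<notin> \<real>) (proots (complex_poly p)) = proots (complex_poly p)"
    by (simp add: filter_mset_eq_conv)
  then show "Z_C p = 2"
    by (simp add: Z_C_def size_proots_complex pc)
qed

end

theory Submission
  imports Defs
begin

text \<open>If all real zeros of a polynomial \<open>f\<close> of odd degree with positive leading coefficient are
  simple, then \<open>f\<close> is increasing at exactly one more of them than it is decreasing. Apply this to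
  \<open>f = H p p'\<close> with \<open>H = H\<^sub>\<kappa>[p]\<close>: it increases at the zeros of \<open>p\<close> and decreases at the \<open>n - 1\<close> zeros
  of \<open>p'\<close>. At a zero of \<open>H\<close>, where \<open>p = \<kappa> p'\<^sup>2 / p''\<close>, one finds
  \<open>H' = \<kappa> (p' / p'') ((2 - 1/\<kappa>) p''\<^sup>2 - p' p''')\<close>; since \<open>2 - 1/\<kappa> \<ge> (n - 2) / (n - 1)\<close>, the last factor
  is positive by the Laguerre inequality for the real-rooted \<open>p'\<close>, so \<open>H' p p' > 0\<close>: the zeros of
  \<open>H\<close> are simple and \<open>f\<close> increases there. With \<open>r\<close> the number of real zeros of \<open>p\<close>, this gives
  \<open>Z\<^sub>\<real>(H) + r - (n - 1) = 1\<close>. That \<open>f\<close> has odd degree and positive leading coefficient is clear unless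
  \<open>\<kappa> = (n - 1) / n\<close>; then the two top coefficients of \<open>H\<close> vanish, and the Newton inequality for \<open>p'\<close>
  shows that the next one is positive.\<close>

section \<open>Signs of the derivative at the simple real zeros of a polynomial\<close>

text \<open>Far to the right a polynomial has the sign of its leading coefficient; another sign at
  \<open>x\<close> would force a zero beyond \<open>x\<close> by the intermediate value
  theorem.\<close>

lemma sgn_poly_eq_sgn_lead_coeff:
  fixes p :: "real poly"
  assumes "\<And>y. y \<ge> x \<Longrightarrow> poly p y \<noteq> 0"
  shows "sgn (poly p x) = sgn (lead_coeff p)"
proof -
  have pos: "poly q x > 0" if lc: "lead_coeff q > 0" and nz: "\<And>y. y \<ge> x \<Longrightarrow> poly q y \<noteq> 0"
    for q :: "real poly"
  proof (rule ccontr)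
    assume "\<not> poly q x > 0"
    with nz[of x] have neg: "poly q x < 0" by simp
    obtain b where b: "\<And>y. y \<ge> b \<Longrightarrow> poly q y \<ge> lead_coeff q"
      using poly_pinfty_gt_lc[OF lc] by blast
    have "poly q (max b (x + 1)) > 0"
      using b[of "max b (x + 1)"] lc by simp
    moreover have "x < max b (x + 1)" by simp
    ultimately obtain y where "y > x" "poly q y = 0"
      using neg poly_IVT_pos[of x "max b (x + 1)" q] by blast
    with nz[of y] show False by simp
  qed
  have "lead_coeff p \<noteq> 0" using assms[of x] by auto
  then consider "lead_coeff p > 0" | "lead_coeff (- p) > 0"
    by (fastforce simp: neq_iff)
  then show ?thesis
  proof cases
    case 1
    then show ?thesis using pos[of p] assms by simp
  next
    case 2
    then have "poly (- p) x > 0" using pos[of "- p"] assms by auto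
    with 2 \<open>lead_coeff p \<noteq> 0\<close> show ?thesis by (auto simp: sgn_if)
  qed
qed

text \<open>Compares \<open>p\<close> with its reflection \<open>p(-x)\<close>: both leading
  coefficients have the sign of the common value at \<open>0\<close>, yet they differ by the factor
  \<open>(-1) ^ degree p\<close>.\<close>

lemma even_degree_if_no_real_root:
  fixes p :: "real poly"
  assumes "\<And>x. poly p x \<noteq> 0"
  shows "even (degree p)"
proof -
  define q where "q = pcompose p [:0, -1:]"
  have "lead_coeff q = lead_coeff p * (-1) ^ degree p"
    unfolding q_def by (subst lead_coeff_comp) auto
  moreover have "sgn (poly p 0) = sgn (lead_coeff p)"
    using assms by (intro sgn_poly_eq_sgn_lead_coeff)
  moreover have "sgn (poly q 0) = sgn (lead_coeff q)"
    using assms by (intro sgn_poly_eq_sgn_lead_coeff) (simp add: q_def poly_pcompose)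
  moreover have "poly q 0 = poly p 0" by (simp add: q_def poly_pcompose)
  moreover have "lead_coeff p \<noteq> 0" using assms[of 0] by auto
  ultimately show ?thesis
    by (cases "even (degree p)") (auto simp: sgn_minus sgn_zero_iff)
qed

text \<open>Induction on the number of real zeros, splitting off the largest one as
  \<open>p = (x - z) q\<close>. Since \<open>p' = q + (x - z) q'\<close>, the sign of
  \<open>p'\<close> at each smaller zero is opposite to that of \<open>q'\<close>, while at
  \<open>z\<close> it is the sign of \<open>q\<close>.\<close>

lemma sum_sgn_pderiv_roots:
  fixes p :: "real poly"
  assumes "\<And>x. poly p x = 0 \<Longrightarrow> poly (pderiv p) x \<noteq> 0"
  shows "2 * (\<Sum>x | poly p x = 0. sgn (poly (pderiv p) x)) =
    sgn (lead_coeff p) * (1 - (-1) ^ degree p)"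
  using assms
proof (induction "card {x. poly p x = 0}" arbitrary: p)
  case (0 p)
  have "p \<noteq> 0" using "0.prems"[of 0] by auto
  with 0 have none: "{x. poly p x = 0} = {}" by (simp add: poly_roots_finite)
  then have "even (degree p)" by (intro even_degree_if_no_real_root) auto
  then show ?case unfolding none by simp
next
  case (Suc k p)
  have "p \<noteq> 0" using Suc.prems[of 0] by auto
  define R where "R = {x. poly p x = 0}"
  have fin: "finite R" using \<open>p \<noteq> 0\<close> by (simp add: R_def poly_roots_finite)
  moreover have "R \<noteq> {}" using Suc.hyps(2) unfolding R_def by (metis card.empty nat.distinct(1))
  ultimately have z: "Max R \<in> R" by simp
  define z where "z = Max R"
  have zR: "z \<in> R" and zmax: "\<And>x. x \<in> R \<Longrightarrow> x \<le> z" using z fin by (auto simp: z_def)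
  have "poly p z = 0" using zR by (simp add: R_def)
  then obtain q where q: "p = [:-z, 1:] * q" by (metis dvdE poly_eq_0_iff_dvd)
  have "q \<noteq> 0" using \<open>p \<noteq> 0\<close> q by auto
  have dp: "poly (pderiv p) x = poly q x + (x - z) * poly (pderiv q) x" for x
    unfolding q pderiv_mult by (simp add: pderiv_pCons algebra_simps)
  have qz: "poly q z \<noteq> 0"
    using Suc.prems[OF \<open>poly p z = 0\<close>] dp by simp
  have R: "{x. poly q x = 0} = R - {z}"
    using qz by (auto simp: R_def q)
  have "k = card {x. poly q x = 0}"
    using Suc.hyps(2) fin zR unfolding R by (simp add: R_def)
  moreover have "poly (pderiv q) x \<noteq> 0" if "poly q x = 0" for x
    using Suc.prems[of x] that dp[of x] by (auto simp: q)
  ultimately have IH: "2 * (\<Sum>x\<in>R - {z}. sgn (poly (pderiv q) x)) =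
      sgn (lead_coeff q) * (1 - (-1) ^ degree q)"
    using Suc.hyps(1)[of q] R by simp
  have "sgn (poly (pderiv p) x) = - sgn (poly (pderiv q) x)" if "x \<in> R - {z}" for x
  proof -
    have "poly q x = 0" using that R by blast
    moreover have "x - z < 0" using that zmax[of x] by force
    ultimately show ?thesis using dp[of x] by (simp add: sgn_mult)
  qed
  then have "(\<Sum>x\<in>R - {z}. sgn (poly (pderiv p) x)) = - (\<Sum>x\<in>R - {z}. sgn (poly (pderiv q) x))"
    by (simp add: sum_negf)
  moreover have "sgn (poly (pderiv p) z) = sgn (lead_coeff q)"
  proof -
    \<comment> \<open>As \<open>z\<close> is the largest zero of \<open>p\<close> and a simple one,
      \<open>q\<close> keeps the sign of its leading coefficient from \<open>z\<close>
      onwards.\<close>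
    have "poly q y \<noteq> 0" if "y \<ge> z" for y
      using that zmax[of y] R by (cases "y = z") (force simp: qz)+
    then show ?thesis using sgn_poly_eq_sgn_lead_coeff[of z q] dp[of z] by simp
  qed
  moreover have "(\<Sum>x\<in>R. sgn (poly (pderiv p) x)) =
      sgn (poly (pderiv p) z) + (\<Sum>x\<in>R - {z}. sgn (poly (pderiv p) x))"
    using fin zR by (rule sum.remove)
  ultimately have "2 * (\<Sum>x\<in>R. sgn (poly (pderiv p) x)) =
      2 * sgn (lead_coeff q) - sgn (lead_coeff q) * (1 - (-1) ^ degree q)"
    using IH by (simp add: algebra_simps)
  moreover have "lead_coeff p = lead_coeff q" unfolding q lead_coeff_mult by simp
  moreover have "degree p = Suc (degree q)"
    using \<open>q \<noteq> 0\<close> unfolding q by (subst degree_mult_eq) auto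
  ultimately show ?case by (simp add: R_def algebra_simps)
qed

section \<open>Laguerre and Newton inequalities for polynomials with only simple real zeros\<close>

text \<open>Strict Cauchy-Schwarz against a constant: the sum of squared deviations from the mean is
  positive because \<open>f\<close> takes two different values.\<close>

lemma power2_sum_less_card_mult_sum_power2:
  fixes f :: "'a \<Rightarrow> real"
  assumes "finite S" "a \<in> S" "b \<in> S" "f a \<noteq> f b"
  shows "(\<Sum>i\<in>S. f i)\<^sup>2 < card S * (\<Sum>i\<in>S. (f i)\<^sup>2)"
proof -
  define m where "m = (\<Sum>i\<in>S. f i) / card S"
  have N: "real (card S) > 0" using assms by (auto simp: card_gt_0_iff)
  have "\<exists>c\<in>S. f c \<noteq> m" using assms by metis
  then have "0 < (\<Sum>i\<in>S. (f i - m)\<^sup>2)"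
    using assms(1) by (auto intro!: sum_pos2)
  also have "\<dots> = (\<Sum>i\<in>S. (f i)\<^sup>2) - 2 * m * (\<Sum>i\<in>S. f i) + card S * m\<^sup>2"
    by (simp add: power2_diff sum.distrib sum_subtractf flip: sum_distrib_left sum_distrib_right)
  also have "\<dots> = (\<Sum>i\<in>S. (f i)\<^sup>2) - (\<Sum>i\<in>S. f i)\<^sup>2 / card S"
    using N by (simp add: m_def field_simps power2_eq_square)
  finally show ?thesis using N by (simp add: field_simps)
qed

text \<open>Both sides have the same degree and leading coefficient and agree at
  \<open>degree p\<close> points, which determines a polynomial.\<close>

lemma poly_eq_prod_of_card_roots:
  fixes p :: "'a :: idom poly"
  assumes "card {x. poly p x = 0} = degree p"
  shows "p = smult (lead_coeff p) (\<Prod>x | poly p x = 0. [:-x, 1:])"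
proof (cases "p = 0")
  case False
  define R where "R = {x. poly p x = 0}"
  have fin: "finite R" using False by (simp add: R_def poly_roots_finite)
  define P where "P = (\<Prod>x\<in>R. [:-x, 1:])"
  have deg: "degree P = degree p"
    unfolding P_def using assms by (subst degree_prod_sum_eq) (auto simp: R_def)
  have "lead_coeff P = 1" by (simp add: P_def lead_coeff_prod)
  then have "coeff p (degree p) = coeff (smult (lead_coeff p) P) (degree p)"
    using deg by simp
  moreover have "poly p z = poly (smult (lead_coeff p) P) z" if "z \<in> R" for z
    using that fin by (simp add: P_def poly_prod) (auto simp: R_def)
  ultimately show ?thesis
    using deg assms unfolding R_def[symmetric] P_def[symmetric]
    by (intro poly_eqI_degree_lead_coeff[of p "degree p" "smult (lead_coeff p) P" R]) auto
qed simp

text \<open>Let s and t be the sums of the reciprocals 1/(x - c) and of their squares. The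
  logarithmic derivative P'/P is s and its derivative is -t, whence P''/P = s^2 - t. Induction on
  \<open>S\<close> avoids rational functions.\<close>

lemma poly_pderiv_prod_linear:
  fixes x :: "'a :: field"
  assumes "finite S" "x \<notin> S"
  defines "P \<equiv> \<Prod>c\<in>S. [:-c, 1:]"
  shows "poly (pderiv P) x = poly P x * (\<Sum>c\<in>S. 1 / (x - c))"
    and "poly (pderiv (pderiv P)) x =
      poly P x * ((\<Sum>c\<in>S. 1 / (x - c))\<^sup>2 - (\<Sum>c\<in>S. (1 / (x - c))\<^sup>2))"
proof -
  let ?P = "\<lambda>S. \<Prod>c\<in>S. [:-c, 1:]"
  have "poly (pderiv (?P S)) x = poly (?P S) x * (\<Sum>c\<in>S. 1 / (x - c)) \<and>
    poly (pderiv (pderiv (?P S))) x =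
      poly (?P S) x * ((\<Sum>c\<in>S. 1 / (x - c))\<^sup>2 - (\<Sum>c\<in>S. (1 / (x - c))\<^sup>2))"
    using assms(1,2)
  proof (induction S)
    case (insert c S)
    define s t where "s = (\<Sum>c\<in>S. 1 / (x - c))" and "t = (\<Sum>c\<in>S. (1 / (x - c))\<^sup>2)"
    have xc: "x - c \<noteq> 0" using insert by auto
    have P: "?P (insert c S) = [:-c, 1:] * ?P S" using insert by simp
    have d1: "pderiv (?P (insert c S)) = ?P S + [:-c, 1:] * pderiv (?P S)"
      unfolding P pderiv_mult by (simp add: pderiv_pCons)
    have d2: "pderiv (pderiv (?P (insert c S))) =
        pderiv (?P S) + pderiv (?P S) + [:-c, 1:] * pderiv (pderiv (?P S))"
      unfolding d1 pderiv_mult pderiv_add by (simp add: pderiv_pCons)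
    have IH: "poly (pderiv (?P S)) x = poly (?P S) x * s"
      "poly (pderiv (pderiv (?P S))) x = poly (?P S) x * (s\<^sup>2 - t)"
      using insert by (auto simp: s_def t_def)
    have sums: "(\<Sum>c\<in>insert c S. 1 / (x - c)) = 1 / (x - c) + s"
      "(\<Sum>c\<in>insert c S. (1 / (x - c))\<^sup>2) = (1 / (x - c))\<^sup>2 + t"
      using insert by (simp_all add: s_def t_def)
    \<comment> \<open>Naming the reciprocal turns the goal into a polynomial identity modulo
      \<open>(x - c) * u = 1\<close>.\<close>
    define u where "u = 1 / (x - c)"
    have u: "(x - c) * u = 1" using xc by (simp add: u_def)
    have e: "poly [:-c, 1:] x = x - c" by simp
    show ?case
      unfolding sums d2 unfolding d1 unfolding P poly_add poly_mult IH e u_def[symmetric]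
      using u by algebra
  qed simp
  then show "poly (pderiv P) x = poly P x * (\<Sum>c\<in>S. 1 / (x - c))"
    and "poly (pderiv (pderiv P)) x =
      poly P x * ((\<Sum>c\<in>S. 1 / (x - c))\<^sup>2 - (\<Sum>c\<in>S. (1 / (x - c))\<^sup>2))"
    by (auto simp: P_def)
qed

text \<open>With s and t as above, taken over the zeros of \<open>q\<close>, one has q' = s q and
  q'' = (s^2 - t) q at \<open>x\<close>. Division by q^2 reduces the claim to s^2 < n t with n =
  \<open>degree q\<close>. This is strict Cauchy-Schwarz for the reciprocals 1/(x - c), at least two
  of which differ.\<close>

lemma strict_Laguerre_inequality:
  fixes q :: "real poly"
  assumes roots: "card {x. poly q x = 0} = degree q" and deg: "degree q \<ge> 2"
    and x: "poly q x \<noteq> 0"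
  shows "degree q * (poly q x * poly (pderiv (pderiv q)) x) < (degree q - 1) * (poly (pderiv q) x)\<^sup>2"
proof -
  define R where "R = {x. poly q x = 0}"
  define s t where "s = (\<Sum>c\<in>R. 1 / (x - c))" and "t = (\<Sum>c\<in>R. (1 / (x - c))\<^sup>2)"
  have "q \<noteq> 0" using x by auto
  then have fin: "finite R" by (simp add: R_def poly_roots_finite)
  define P where "P = (\<Prod>c\<in>R. [:-c, 1:])"
  have q: "q = smult (lead_coeff q) P"
    using poly_eq_prod_of_card_roots[OF roots] by (simp add: P_def R_def)
  have "x \<notin> R" using x by (simp add: R_def)
  note dP = poly_pderiv_prod_linear[OF fin this, folded P_def s_def t_def]
  have q0: "poly q x = lead_coeff q * poly P x"
    by (subst q) simp
  have q1: "poly (pderiv q) x = poly q x * s"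
    by (subst q) (simp add: pderiv_smult dP q0)
  have q2: "poly (pderiv (pderiv q)) x = poly q x * (s\<^sup>2 - t)"
    by (subst q) (simp add: pderiv_smult dP q0)
  have "card R \<ge> 2" using roots deg by (simp add: R_def)
  then obtain a b where ab: "a \<in> R" "b \<in> R" "a \<noteq> b"
    by (metis card_2_iff' obtain_subset_with_card_n subsetD)
  have "1 / (x - a) \<noteq> 1 / (x - b)"
    using ab \<open>x \<notin> R\<close> by (auto simp: field_simps)
  then have "s\<^sup>2 < degree q * t"
    using power2_sum_less_card_mult_sum_power2[OF fin ab(1,2), of "\<lambda>c. 1 / (x - c)"] roots
    by (simp add: s_def t_def R_def)
  then have "0 < (poly q x)\<^sup>2 * (degree q * t - s\<^sup>2)"
    using x by (intro mult_pos_pos) auto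
  then show ?thesis unfolding q1 q2 using deg
    by (simp add: of_nat_diff algebra_simps power2_eq_square)
qed

text \<open>Vieta's formulas, with the second elementary symmetric function written through power
  sums. Reversed factors place the top coefficients of the product of the \<open>x - c\<close> at
  the fixed indices 0, 1 and 2.\<close>

lemma coeff_prod_reversed_linear:
  fixes S :: "'a :: field_char_0 set"
  assumes "finite S"
  defines "P \<equiv> \<Prod>c\<in>S. [:1, -c:]"
  shows "coeff P 0 = 1" "coeff P 1 = - \<Sum>S" "2 * coeff P 2 = (\<Sum>S)\<^sup>2 - (\<Sum>c\<in>S. c\<^sup>2)"
proof -
  have "coeff (\<Prod>c\<in>S. [:1, -c:]) 0 = 1 \<and> coeff (\<Prod>c\<in>S. [:1, -c:]) 1 = - \<Sum>S \<and>
    2 * coeff (\<Prod>c\<in>S. [:1, -c:]) 2 = (\<Sum>S)\<^sup>2 - (\<Sum>c\<in>S. c\<^sup>2)"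
    using assms(1)
  proof (induction S)
    case (insert c S)
    let ?P = "\<Prod>c\<in>S. [:1, -c:]"
    have P: "(\<Prod>c\<in>insert c S. [:1, -c:]) = ?P + pCons 0 (smult (- c) ?P)"
      using insert by simp
    have "coeff (\<Prod>c\<in>insert c S. [:1, -c:]) (Suc k) = coeff ?P (Suc k) - c * coeff ?P k" for k
      unfolding P by simp
    from this[of 0] this[of 1] insert show ?case
      by (simp add: P numeral_2_eq_2 power2_eq_square algebra_simps)
  qed simp
  then show "coeff P 0 = 1" "coeff P 1 = - \<Sum>S" "2 * coeff P 2 = (\<Sum>S)\<^sup>2 - (\<Sum>c\<in>S. c\<^sup>2)"
    by (auto simp: P_def)
qed

text \<open>Let S1 and S2 be the sums of the zeros and of their squares. The three top coefficients
  are l, -l S1 and l (S1^2 - S2)/2, so the claim reduces to S1^2 < (m + 2) S2, again strict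
  Cauchy-Schwarz.\<close>

lemma strict_Newton_inequality:
  fixes q :: "real poly"
  assumes roots: "card {x. poly q x = 0} = degree q" and deg: "degree q = Suc (Suc m)"
  shows "2 * (m + 2) * (coeff q (m + 2) * coeff q m) < (m + 1) * (coeff q (m + 1))\<^sup>2"
proof -
  define R where "R = {x. poly q x = 0}"
  define l where "l = lead_coeff q"
  have "q \<noteq> 0" using deg by auto
  then have fin: "finite R" and l: "l \<noteq> 0" by (auto simp: R_def l_def poly_roots_finite)
  \<comment> \<open>Reversal turns \<open>x - c\<close> into \<open>1 - c x\<close>, including the
    factor 1 for \<open>c = 0\<close>.\<close>
  have "reflect_poly q = smult l (\<Prod>c\<in>R. [:1, -c:])"
    by (subst poly_eq_prod_of_card_roots[OF roots])
      (simp add: reflect_poly_smult reflect_poly_prod reflect_poly_pCons' monom_Suc monom_0 R_def l_def)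
  then have c: "coeff (reflect_poly q) k = l * coeff (\<Prod>c\<in>R. [:1, -c:]) k" for k
    by simp
  note P = coeff_prod_reversed_linear[OF fin]
  have c0: "coeff q (m + 2) = l" by (simp add: l_def deg)
  have c1: "coeff q (m + 1) = - l * \<Sum>R"
    using c[of 1] P by (simp add: coeff_reflect_poly deg)
  have c2: "2 * coeff q m = l * ((\<Sum>R)\<^sup>2 - (\<Sum>c\<in>R. c\<^sup>2))"
    using c[of 2] P(3) by (simp add: coeff_reflect_poly deg)
  have "card R \<ge> 2" using roots deg by (simp add: R_def)
  then obtain a b where ab: "a \<in> R" "b \<in> R" "a \<noteq> b"
    by (metis card_2_iff' obtain_subset_with_card_n subsetD)
  then have "(\<Sum>R)\<^sup>2 < (m + 2) * (\<Sum>c\<in>R. c\<^sup>2)"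
    using power2_sum_less_card_mult_sum_power2[OF fin ab(1,2), of "\<lambda>c. c"] roots
    by (simp add: R_def deg)
  then have "0 < l\<^sup>2 * ((m + 2) * (\<Sum>c\<in>R. c\<^sup>2) - (\<Sum>R)\<^sup>2)"
    using l by (intro mult_pos_pos) auto
  also have "\<dots> = (m + 1) * (coeff q (m + 1))\<^sup>2 - (m + 2) * coeff q (m + 2) * (2 * coeff q m)"
    unfolding c0 c1 c2 by (simp add: algebra_simps power2_eq_square)
  finally show ?thesis by (simp add: algebra_simps)
qed

text \<open>Only the terms of the convolution in which both indices are at most \<open>m + 2\<close>
  survive.\<close>

lemma coeff_mult_top:
  fixes f g :: "'a :: comm_semiring_1 poly"
  assumes "degree f \<le> m + 2" "degree g \<le> m + 2"
  shows "coeff (f * g) (2 * m + 4) = coeff f (m + 2) * coeff g (m + 2)"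
    and "coeff (f * g) (2 * m + 3) =
      coeff f (m + 1) * coeff g (m + 2) + coeff f (m + 2) * coeff g (m + 1)"
    and "coeff (f * g) (2 * m + 2) = coeff f m * coeff g (m + 2) +
      coeff f (m + 1) * coeff g (m + 1) + coeff f (m + 2) * coeff g m"
proof -
  have *: "coeff (f * g) k = (\<Sum>i\<in>S. coeff f i * coeff g (k - i))"
    if "S \<subseteq> {..k}" "\<And>i. i \<in> {..k} - S \<Longrightarrow> m + 2 < i \<or> m + 2 < k - i" for k S
    unfolding coeff_mult using that assms
    by (intro sum.mono_neutral_right ballI finite_atMost)
      (metis coeff_eq_0 le_less_trans mult_zero_left mult_zero_right)+
  show "coeff (f * g) (2 * m + 4) = coeff f (m + 2) * coeff g (m + 2)"
    by (subst *[of "{m + 2}"]) auto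
  show "coeff (f * g) (2 * m + 3) =
      coeff f (m + 1) * coeff g (m + 2) + coeff f (m + 2) * coeff g (m + 1)"
    by (subst *[of "{m + 1, m + 2}"]) auto
  show "coeff (f * g) (2 * m + 2) = coeff f m * coeff g (m + 2) +
      coeff f (m + 1) * coeff g (m + 1) + coeff f (m + 2) * coeff g m"
    by (subst *[of "{m, m + 1, m + 2}"]) (auto simp: add_ac)
qed

section \<open>Simple zeros, and the passage between real and complex zeros\<close>

lemma poly_complex_poly_of_real:
  "poly (complex_poly p) (of_real x) = of_real (poly p x)"
  by (induction p) (simp_all add: map_poly_pCons)

lemma pderiv_complex_poly: "pderiv (complex_poly p) = complex_poly (pderiv p)"
  by (rule poly_eqI) (simp add: coeff_pderiv coeff_map_poly)

lemma real_roots_complex_poly: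
  "{z. poly (complex_poly p) z = 0 \<and> z \<in> \<real>} = of_real ` {x. poly p x = 0}"
  by (auto simp: poly_complex_poly_of_real elim!: Reals_cases)

lemma rsquarefree_if_real_zeros_simple:
  assumes "real_zeros_simple p" "p \<noteq> 0"
  shows "rsquarefree p"
  using assms by (auto simp: rsquarefree_def real_zeros_simple_def order_root)

lemma proots_rsquarefree:
  assumes "rsquarefree p"
  shows "proots p = mset_set {x. poly p x = 0}"
proof (rule multiset_eqI)
  fix x
  have "p \<noteq> 0" using assms by (simp add: rsquarefree_def)
  then have "finite {x. poly p x = 0}" by (rule poly_roots_finite)
  then show "count (proots p) x = count (mset_set {x. poly p x = 0}) x"
    using \<open>p \<noteq> 0\<close> rsquarefree_root_order[OF assms, of x]
    by (cases "poly p x = 0") (auto simp: count_mset_set order_0I)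
qed

lemma size_proots_rsquarefree:
  assumes "rsquarefree p"
  shows "size (proots p) = card {x. poly p x = 0}"
  using assms by (simp add: proots_rsquarefree)

text \<open>The complex zeros number \<open>degree p\<close> with multiplicity. A real zero stays
  simple over the complex numbers since \<open>p'\<close> does not vanish there, so the real ones
  contribute exactly their cardinality.\<close>

lemma Z_C_add_card_real_roots:
  assumes "rsquarefree p"
  shows "Z_C p + card {x. poly p x = 0} = degree p"
proof -
  let ?M = "filter_mset (\<lambda>z. z \<in> \<real>) (proots (complex_poly p))"
  have "p \<noteq> 0" using assms by (simp add: rsquarefree_def)
  then have cp: "complex_poly p \<noteq> 0" by (simp add: map_poly_eq_0_iff)
  have fin: "finite (complex_of_real ` {x. poly p x = 0})"
    using \<open>p \<noteq> 0\<close> by (simp add: poly_roots_finite)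
  have "order (of_real x) (complex_poly p) = 1" if "poly p x = 0" for x
  proof -
    have "poly (pderiv p) x \<noteq> 0" using assms that by (auto simp: rsquarefree_roots)
    then have "poly (pderiv (complex_poly p)) (of_real x) \<noteq> 0"
      by (simp add: pderiv_complex_poly poly_complex_poly_of_real)
    then show ?thesis
      using order_pderiv[OF cp, of "of_real x"] that
      by (simp add: poly_complex_poly_of_real order_0I)
  qed
  then have count: "count ?M (of_real x) = (if poly p x = 0 then 1 else 0)" for x
    using cp by (simp add: poly_complex_poly_of_real order_0I)
  have "?M = mset_set (of_real ` {x. poly p x = 0})"
  proof (rule multiset_eqI)
    fix z
    show "count ?M z = count (mset_set (of_real ` {x. poly p x = 0})) z"
    proof (cases "z \<in> \<real>")
      case True
      then obtain x where "z = of_real x" by (elim Reals_cases)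
      then show ?thesis using count fin by (auto simp: count_mset_set')
    qed (auto simp: count_mset_set')
  qed
  then have "size ?M = card {x. poly p x = 0}"
    by (simp add: card_image inj_on_def)
  moreover have "size ?M + Z_C p = size (proots (complex_poly p))"
    unfolding Z_C_def by (metis multiset_partition size_union)
  ultimately show ?thesis
    by (simp add: size_proots_complex degree_map_poly)
qed

text \<open>By the fundamental theorem of algebra there are \<open>degree q\<close> complex zeros
  with multiplicity; being simple and real, they are the images of as many distinct real
  ones.\<close>

lemma all_zeros_real_simpleD:
  assumes "all_zeros_real_simple q" "q \<noteq> 0"
  shows "rsquarefree q" and "card {x. poly q x = 0} = degree q"
proof -
  let ?c = "complex_poly q"
  have "?c \<noteq> 0" using assms(2) by (simp add: map_poly_eq_0_iff)
  then have sq: "rsquarefree ?c"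
    using assms(1) unfolding rsquarefree_def all_zeros_real_simple_def by (metis order_root)
  then show "rsquarefree q"
    unfolding rsquarefree_roots pderiv_complex_poly
    by (metis of_real_0 poly_complex_poly_of_real)
  have "{z. poly ?c z = 0} = of_real ` {x. poly q x = 0}"
    using assms(1) real_roots_complex_poly[of q] by (auto simp: all_zeros_real_simple_def)
  then have "card {x. poly q x = 0} = card {z. poly ?c z = 0}"
    by (simp add: card_image inj_on_def)
  also have "\<dots> = degree ?c"
    using size_proots_rsquarefree[OF sq] by (simp add: size_proots_complex)
  finally show "card {x. poly q x = 0} = degree q" by (simp add: degree_map_poly)
qed

section \<open>The derivative of \<open>H\<close> at its zeros, and the leading term of
  \<open>H\<close>\<close>

lemma poly_H: "poly (H \<kappa> p) x =
    \<kappa> * (poly (pderiv p) x)\<^sup>2 - poly p x * poly (pderiv (pderiv p)) x"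
  by (simp add: H_def)

lemma pderiv_H: "pderiv (H \<kappa> p) = smult (2 * \<kappa> - 1) (pderiv p * pderiv (pderiv p))
    - p * pderiv (pderiv (pderiv p))"
proof -
  have "pderiv (H \<kappa> p) = smult \<kappa> (pderiv p * pderiv (pderiv p) + pderiv p * pderiv (pderiv p))
      - (p * pderiv (pderiv (pderiv p)) + pderiv p * pderiv (pderiv p))"
    by (simp add: H_def pderiv_diff pderiv_smult pderiv_mult power2_eq_square mult.commute)
  then show ?thesis by (simp add: poly_eq_poly_eq_iff[symmetric] fun_eq_iff algebra_simps)
qed

text \<open>Substituting p p'' = \<kappa> p'^2 into H' p p' and multiplying by p''^2, which avoids
  division, gives \<kappa> p'^4 ((2 \<kappa> - 1) p''^2 - \<kappa> p' p''').\<close>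

lemma pderiv_H_at_root:
  fixes p :: "real poly"
  assumes "\<kappa> > 0" and root: "poly (H \<kappa> p) x = 0" and p': "poly (pderiv p) x \<noteq> 0"
    and H': "\<kappa> * (poly (pderiv p) x * poly (pderiv (pderiv (pderiv p))) x)
      < (2 * \<kappa> - 1) * (poly (pderiv (pderiv p)) x)\<^sup>2"
  shows "poly (pderiv (H \<kappa> p)) x * (poly p x * poly (pderiv p) x) > 0"
proof -
  define a b c d where "a = poly p x" and "b = poly (pderiv p) x"
    and "c = poly (pderiv (pderiv p)) x" and "d = poly (pderiv (pderiv (pderiv p))) x"
  have ac: "a * c = \<kappa> * b\<^sup>2" using root by (simp add: poly_H a_def b_def c_def)
  have b: "b \<noteq> 0" using p' by (simp add: b_def)
  then have c: "c \<noteq> 0" using ac \<open>\<kappa> > 0\<close> by auto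
  have D: "poly (pderiv (H \<kappa> p)) x = (2 * \<kappa> - 1) * (b * c) - a * d"
    by (simp add: pderiv_H a_def b_def c_def d_def)
  have "0 < \<kappa> * b ^ 4 * ((2 * \<kappa> - 1) * c\<^sup>2 - \<kappa> * (b * d))"
    using b \<open>\<kappa> > 0\<close> H' by (intro mult_pos_pos) (auto simp: b_def c_def d_def)
  also have "\<dots> = c\<^sup>2 * (((2 * \<kappa> - 1) * (b * c) - a * d) * (a * b))"
    using ac by algebra
  finally show ?thesis
    using c unfolding D by (simp add: zero_less_mult_iff a_def b_def)
qed

text \<open>The factor \<open>x\<^sup>2\<close> makes \<open>p\<close>, \<open>x p'\<close> and \<open>x\<^sup>2 p''\<close> have the same degree bound and diagonal
  coefficients \<open>1\<close>, \<open>i\<close> and \<open>i (i - 1)\<close>, so that no truncated index subtraction arises.\<close>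

lemma coeff_monom_mult_H:
  fixes p :: "real poly" and \<kappa> :: real
  assumes deg: "degree p \<le> m + 2"
  defines "G \<equiv> monom 1 2 * H \<kappa> p"
  shows "degree G \<le> 2 * m + 4"
    and "coeff G (2 * m + 4) = (real m + 2) * (\<kappa> * (real m + 2) - (real m + 1)) * (coeff p (m + 2))\<^sup>2"
    and "coeff G (2 * m + 3) =
      2 * (real m + 1) * (\<kappa> * (real m + 2) - (real m + 1)) * (coeff p (m + 2) * coeff p (m + 1))"
    and "coeff G (2 * m + 2) =
      \<kappa> * (2 * real m * (real m + 2) * (coeff p (m + 2) * coeff p m) + (real m + 1)\<^sup>2 * (coeff p (m + 1))\<^sup>2)
      - (real m * (real m - 1) + (real m + 2) * (real m + 1)) * (coeff p (m + 2) * coeff p m)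
      - (real m + 1) * real m * (coeff p (m + 1))\<^sup>2"
proof -
  define u v where "u = pCons 0 (pderiv p)" and "v = monom 1 2 * pderiv (pderiv p)"
  have cu: "coeff u i = i * coeff p i" for i
    by (cases i) (auto simp: u_def coeff_pderiv)
  have cv: "coeff v i = i * (real i - 1) * coeff p i" for i
  proof (cases "i < 2")
    case True
    then have "i = 0 \<or> i = 1" by auto
    with True show ?thesis by (auto simp: v_def coeff_monom_mult)
  next
    case False
    then obtain j where "i = Suc (Suc j)" by (metis add_2_eq_Suc le_Suc_ex not_less)
    then show ?thesis by (simp add: v_def coeff_monom_mult coeff_pderiv numeral_2_eq_2)
  qed
  have G: "G = smult \<kappa> (u * u) - p * v"
    by (simp add: G_def H_def u_def v_def poly_eq_poly_eq_iff[symmetric] fun_eq_iff poly_monom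
        power2_eq_square algebra_simps)
  have du: "degree u \<le> m + 2" and dv: "degree v \<le> m + 2"
    using deg by (auto intro!: degree_le simp: cu cv coeff_eq_0)
  show "degree G \<le> 2 * m + 4"
    unfolding G
  proof (rule degree_diff_le)
    show "degree (smult \<kappa> (u * u)) \<le> 2 * m + 4"
      using degree_smult_le[of \<kappa> "u * u"] degree_mult_le[of u u] du by linarith
    show "degree (p * v) \<le> 2 * m + 4"
      using degree_mult_le[of p v] deg dv by linarith
  qed
  note uu = coeff_mult_top[OF du du] and pv = coeff_mult_top[OF deg dv]
  show "coeff G (2 * m + 4) = (real m + 2) * (\<kappa> * (real m + 2) - (real m + 1)) * (coeff p (m + 2))\<^sup>2"
    unfolding G coeff_diff coeff_smult uu pv cu cv
    by (simp add: power2_eq_square algebra_simps)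
  show "coeff G (2 * m + 3) =
      2 * (real m + 1) * (\<kappa> * (real m + 2) - (real m + 1)) * (coeff p (m + 2) * coeff p (m + 1))"
    unfolding G coeff_diff coeff_smult uu pv cu cv
    by (simp add: power2_eq_square algebra_simps)
  show "coeff G (2 * m + 2) =
      \<kappa> * (2 * real m * (real m + 2) * (coeff p (m + 2) * coeff p m) + (real m + 1)\<^sup>2 * (coeff p (m + 1))\<^sup>2)
      - (real m * (real m - 1) + (real m + 2) * (real m + 1)) * (coeff p (m + 2) * coeff p m)
      - (real m + 1) * real m * (coeff p (m + 1))\<^sup>2"
    unfolding G coeff_diff coeff_smult uu pv cu cv
    by (simp add: power2_eq_square algebra_simps)
qed

text \<open>Removes the auxiliary factor \<open>x^k\<close>, which shifts the degree by an even
  number and keeps the leading coefficient.\<close>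

lemma degree_lead_coeff_of_monom_mult:
  fixes h :: "real poly"
  assumes "degree (monom 1 k * h) \<le> d" "coeff (monom 1 k * h) d > 0" "even k" "even d"
  shows "even (degree h)" and "lead_coeff h > 0"
proof -
  have d: "degree (monom 1 k * h) = d"
    using assms(1,2) by (intro antisym le_degree) auto
  have "h \<noteq> 0" using assms(2) by auto
  then have "d = k + degree h"
    using d by (simp add: degree_mult_eq degree_monom_eq monom_eq_0_iff)
  then show "even (degree h)" and "lead_coeff h > 0"
    using assms by (auto simp: coeff_monom_mult)
qed

text \<open>Above the threshold for \<kappa> the coefficient at \<open>2 * m + 4\<close> is
  positive. At the threshold it vanishes together with the next one, and \<open>newton\<close>
  decides the sign of the coefficient at \<open>2 * m + 2\<close>.\<close>

lemma H_even_degree_pos_lead_coeff: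
  fixes p :: "real poly"
  assumes deg: "degree p = m + 2" and \<kappa>: "\<kappa> * (real m + 2) \<ge> real m + 1"
    and newton: "\<kappa> * (real m + 2) = real m + 1 \<Longrightarrow>
      2 * (real m + 2) * (coeff p (m + 2) * coeff p m) < (real m + 1) * (coeff p (m + 1))\<^sup>2"
  shows "even (degree (H \<kappa> p))" and "lead_coeff (H \<kappa> p) > 0"
proof -
  let ?G = "monom 1 2 * H \<kappa> p"
  have "degree p \<le> m + 2" using deg by simp
  note G = coeff_monom_mult_H[OF this, of \<kappa>]
  have "\<exists>d. degree ?G \<le> d \<and> coeff ?G d > 0 \<and> even d"
  proof (cases "\<kappa> * (real m + 2) = real m + 1")
    case False
    then have "\<kappa> * (real m + 2) - (real m + 1) > 0" using \<kappa> by simp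
    moreover have "coeff p (m + 2) \<noteq> 0" 
      using deg leading_coeff_0_iff[of p] by auto
    ultimately have "coeff ?G (2 * m + 4) > 0" unfolding G(2) by (intro mult_pos_pos) auto
    with G(1) show ?thesis by (intro exI[of _ "2 * m + 4"]) auto
  next
    case True
    let ?a = "coeff p (m + 2)" and ?b = "coeff p (m + 1)" and ?c = "coeff p m"
    have zero: "coeff ?G (2 * m + 4) = 0" "coeff ?G (2 * m + 3) = 0"
      unfolding G(2,3) using True by simp_all
    have "degree ?G \<le> 2 * m + 2"
    proof (intro degree_le allI impI)
      fix i assume "2 * m + 2 < i"
      then have "i = 2 * m + 3 \<or> i = 2 * m + 4 \<or> degree ?G < i" using G(1) by linarith
      with zero show "coeff ?G i = 0" by (auto simp: coeff_eq_0)
    qed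
    \<comment> \<open>The factor \<open>real m + 2\<close> clears the denominator of \<kappa> = (m +
      1)/(m + 2).\<close>
    moreover have "coeff ?G (2 * m + 2) * (real m + 2) =
        (real m + 1) * (coeff p (m + 1))\<^sup>2 - 2 * (real m + 2) * (coeff p (m + 2) * coeff p m)"
      using True unfolding G(4) by algebra
    then have "coeff ?G (2 * m + 2) > 0"
      using newton[OF True] zero_less_mult_pos2[of "coeff ?G (2 * m + 2)" "real m + 2"] by simp
    ultimately show ?thesis by (intro exI[of _ "2 * m + 2"]) auto
  qed
  then show "even (degree (H \<kappa> p))" and "lead_coeff (H \<kappa> p) > 0"
    using degree_lead_coeff_of_monom_mult[of 2 "H \<kappa> p"] by auto
qed

section \<open>Counting the real zeros of \<open>H\<close>\<close>

lemma card_real_roots_H: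
  assumes "rsquarefree p" "rsquarefree (pderiv p)"
    and roots': "card {x. poly (pderiv p) x = 0} = degree (pderiv p)" and "\<kappa> > 0"
    and root: "\<And>x. poly (H \<kappa> p) x = 0 \<Longrightarrow>
      poly (pderiv (H \<kappa> p)) x * (poly p x * poly (pderiv p) x) > 0"
    and H: "even (degree (H \<kappa> p))" "lead_coeff (H \<kappa> p) > 0"
  shows "card {x. poly (H \<kappa> p) x = 0} + card {x. poly p x = 0} = degree p"
proof -
  let ?h = "H \<kappa> p" and ?p' = "pderiv p"
  let ?p'' = "pderiv ?p'"
  let ?R = "\<lambda>q :: real poly. {x. poly q x = 0}"
  define f where "f = ?h * (p * ?p')"
  have nz: "p \<noteq> 0" "?p' \<noteq> 0" "?h \<noteq> 0" using assms(1,2) H by (auto simp: rsquarefree_def)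
  then have fin: "finite (?R p)" "finite (?R ?p')" "finite (?R ?h)" by (simp_all add: poly_roots_finite)
  have p': "poly ?p' x \<noteq> 0" if "poly p x = 0" for x
    using assms(1) that by (auto simp: rsquarefree_roots)
  have p'': "poly ?p'' x \<noteq> 0" if "poly ?p' x = 0" for x
    using assms(2) that by (auto simp: rsquarefree_roots)
  have df: "poly (pderiv f) x = poly (pderiv ?h) x * (poly p x * poly ?p' x) +
      poly ?h x * (poly p x * poly ?p'' x + (poly ?p' x)\<^sup>2)" for x
    by (simp add: f_def pderiv_mult power2_eq_square algebra_simps)
  \<comment> \<open>The derivative of \<open>f\<close> is H' p p' at a zero of \<open>H\<close>,
    \<kappa> p'^4 at a zero of \<open>p\<close>, and -(p p'')^2 at a zero of
    \<open>p'\<close>.\<close>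
  have sh: "poly (pderiv f) x > 0" if "x \<in> ?R ?h" for x
    using that root[of x] by (simp add: df)
  have sp: "poly (pderiv f) x > 0" if "x \<in> ?R p" for x
    using that p'[of x] \<open>\<kappa> > 0\<close> by (simp add: df poly_H)
  have sp': "poly (pderiv f) x < 0" if "x \<in> ?R ?p'" for x
  proof -
    have "poly p x \<noteq> 0" "poly ?p'' x \<noteq> 0" using that p'[of x] p''[of x] by auto
    then show ?thesis using that by (simp add: df poly_H flip: power2_eq_square)
  qed
  have Rf: "?R f = ?R ?h \<union> (?R p \<union> ?R ?p')" by (auto simp: f_def)
  have "poly (pderiv f) x \<noteq> 0" if "poly f x = 0" for x
  proof -
    from that have "x \<in> ?R ?h \<or> x \<in> ?R p \<or> x \<in> ?R ?p'" by (auto simp: f_def)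
    then show ?thesis using sh sp sp' by (metis less_irrefl)
  qed
  then have "2 * (\<Sum>x\<in>?R f. sgn (poly (pderiv f) x)) = sgn (lead_coeff f) * (1 - (-1) ^ degree f)"
    by (rule sum_sgn_pderiv_roots)
  moreover have "lead_coeff f > 0"
  proof -
    have deg: "degree p > 0" using nz(2) by (simp add: pderiv_eq_0_iff)
    then have "lead_coeff ?p' = degree p * lead_coeff p"
      by (simp add: degree_pderiv coeff_pderiv)
    then have "lead_coeff f = lead_coeff ?h * (degree p * (lead_coeff p)\<^sup>2)"
      unfolding f_def lead_coeff_mult by (simp add: power2_eq_square)
    then show ?thesis using H deg nz(1) by simp
  qed
  moreover have deg: "degree p = Suc (degree ?p')"
    using nz(2) by (simp add: degree_pderiv pderiv_eq_0_iff)
  then have "odd (degree f)"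
    using nz H(1) by (simp add: f_def degree_mult_eq)
  ultimately have total: "(\<Sum>x\<in>?R f. sgn (poly (pderiv f) x)) = 1" by simp
  \<comment> \<open>At a zero of \<open>H\<close> the strict inequality \<open>root\<close> excludes
    a zero of \<open>p\<close> or \<open>p'\<close>.\<close>
  have disj: "?R ?h \<inter> (?R p \<union> ?R ?p') = {}" "?R p \<inter> ?R ?p' = {}"
    using root p' by force+
  have const: "(\<Sum>x\<in>A. sgn (poly (pderiv f) x)) = c * card A"
    if "\<And>x. x \<in> A \<Longrightarrow> sgn (poly (pderiv f) x) = c" for A c
    using that by simp
  have "(\<Sum>x\<in>?R f. sgn (poly (pderiv f) x)) = (\<Sum>x\<in>?R ?h. sgn (poly (pderiv f) x)) +
      ((\<Sum>x\<in>?R p. sgn (poly (pderiv f) x)) + (\<Sum>x\<in>?R ?p'. sgn (poly (pderiv f) x)))"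
    unfolding Rf using fin disj by (simp only: sum.union_disjoint finite_Un simp_thms)
  also have "\<dots> = real (card (?R ?h)) + (real (card (?R p)) - real (card (?R ?p')))"
    using const[of "?R ?h" 1] const[of "?R p" 1] const[of "?R ?p'" "-1"] sh sp sp' by simp
  finally show ?thesis using total roots' deg by linarith
qed

theorem theorem2p2:
  fixes \<kappa> :: real and n :: nat and p :: "real poly"
  assumes "degree p = n" and "n \<ge> 2"
    and "\<kappa> \<ge> (real n - 1) / real n"
    and "real_zeros_simple p"
    and "all_zeros_real_simple (pderiv p)"
    and "\<not> (n = 2 \<and> \<kappa> = 1 / 2 \<and> (\<forall>x. poly p x \<noteq> 0))"
  shows "Z_R (H \<kappa> p) = Z_C p"
proof -
  obtain m where n: "n = m + 2" using assms(2) by (metis add.commute le_Suc_ex)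
  define q where "q = pderiv p"
  have "p \<noteq> 0" using assms(1,2) by auto
  then have sp: "rsquarefree p" using assms(4) by (intro rsquarefree_if_real_zeros_simple)
  have dq: "degree q = m + 1" using assms(1) n by (simp add: q_def degree_pderiv)
  then have "q \<noteq> 0" by auto
  then have sq: "rsquarefree q" and rq: "card {x. poly q x = 0} = degree q"
    using assms(5) all_zeros_real_simpleD[of q] by (simp_all add: q_def)
  have \<kappa>: "\<kappa> * (real m + 2) \<ge> real m + 1"
    using assms(3) by (simp add: n field_simps)
  have "0 < \<kappa> * (real m + 2)" using \<kappa> by linarith
  then have "\<kappa> > 0" by (simp add: zero_less_mult_iff)
  have *: "even (degree (H \<kappa> p)) \<and> lead_coeff (H \<kappa> p) > 0 \<and> (\<forall>x. poly (H \<kappa> p) x = 0 \<longrightarrow>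
      poly (pderiv (H \<kappa> p)) x * (poly p x * poly q x) > 0)"
  proof (cases "n = 2 \<and> \<kappa> = 1 / 2")
    case True
    \<comment> \<open>Here \<open>H\<close> is constant, because 2 \<kappa> - 1 and p''' vanish. Its
      value at the real zero \<open>z\<close> is \<kappa> p'(z)^2 > 0, so it has no zeros to
      check.\<close>
    with assms(6) obtain z where z: "poly p z = 0" by auto
    then have "poly q z \<noteq> 0" using sp by (auto simp: rsquarefree_roots q_def)
    then have "poly (H \<kappa> p) z > 0" using z \<open>\<kappa> > 0\<close> by (simp add: poly_H q_def)
    moreover have "pderiv (pderiv q) = 0"
      using dq True n by (simp add: pderiv_eq_0_iff degree_pderiv)
    then have "pderiv (H \<kappa> p) = 0" using True by (simp add: pderiv_H q_def)
    then obtain h where "H \<kappa> p = [:h:]" using pderiv_iszero by blast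
    ultimately show ?thesis by simp
  next
    case False
    have strict: "\<kappa> * (poly q x * poly (pderiv (pderiv q)) x) < (2 * \<kappa> - 1) * (poly (pderiv q) x)\<^sup>2"
      if "poly q x \<noteq> 0" for x
    \<comment> \<open>For \<open>m = 0\<close> the derivative is linear, below the degree 2 that the
      Laguerre inequality requires; then p''' = 0, and 2 \<kappa> - 1 > 0 since \<kappa> = 1/2
      belongs to the other case.\<close>
    proof (cases "m = 0")
      case True
      then have "\<kappa> \<ge> 1 / 2" using \<kappa> by simp
      then have "2 * \<kappa> - 1 > 0" using False True n by simp
      obtain c where c: "pderiv q = [:c:]"
        using dq True by (metis add_0 degree_pderiv degree_eq_zeroE diff_self_eq_0)
      moreover have "pderiv q \<noteq> 0" using dq by (simp add: pderiv_eq_0_iff)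
      ultimately show ?thesis using \<open>2 * \<kappa> - 1 > 0\<close> by (simp add: pderiv_pCons)
    next
      case False
      let ?A = "poly q x * poly (pderiv (pderiv q)) x" and ?B = "(poly (pderiv q) x)\<^sup>2"
      have "(real m + 1) * ?A < real m * ?B"
        using strict_Laguerre_inequality[OF rq _ that] dq False by (simp add: add.commute)
      then have "\<kappa> * ((real m + 1) * ?A) < \<kappa> * (real m * ?B)" using \<open>\<kappa> > 0\<close> by simp
      \<comment> \<open>The bound \<kappa> m \<le> (m + 1)(2 \<kappa> - 1) is a rearrangement of
        \<kappa> (m + 2) \<ge> m + 1.\<close>
      also have "\<dots> \<le> (real m + 1) * ((2 * \<kappa> - 1) * ?B)"
        using mult_right_mono[OF \<kappa>, of ?B] by (simp add: algebra_simps)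
      finally have "(real m + 1) * (\<kappa> * ?A) < (real m + 1) * ((2 * \<kappa> - 1) * ?B)"
        by (simp add: mult.left_commute)
      then show ?thesis by (simp add: add_pos_nonneg)
    qed
    have "poly (pderiv (H \<kappa> p)) x * (poly p x * poly q x) > 0" if "poly (H \<kappa> p) x = 0" for x
    proof -
      \<comment> \<open>If \<open>p'\<close> vanished at a zero of \<open>H\<close>, so would p p'',
        but neither \<open>p\<close> nor p'' shares a zero with \<open>p'\<close>.\<close>
      have "poly p x * poly (pderiv q) x \<noteq> 0 \<or> poly q x \<noteq> 0"
        using sp sq by (auto simp: rsquarefree_roots q_def)
      then have "poly q x \<noteq> 0" using that by (auto simp: poly_H q_def)
      then show ?thesis
        using pderiv_H_at_root[OF \<open>\<kappa> > 0\<close> that] strict[of x] by (simp add: q_def)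
    qed
    moreover have "2 * (real m + 2) * (coeff p (m + 2) * coeff p m) < (real m + 1) * (coeff p (m + 1))\<^sup>2"
      if eq: "\<kappa> * (real m + 2) = real m + 1"
    proof -
      \<comment> \<open>Equality with \<open>m = 0\<close> would be the case \<open>n = 2\<close>,
        \<kappa> = 1/2. Thus \<open>q\<close> has degree \<open>k + 2\<close> with
        \<open>m = k + 1\<close>, and its Newton inequality becomes the one for \<open>p\<close>
        after cancelling \<open>(k + 1) (k + 2)\<close>.\<close>
      have "m \<noteq> 0"
        using False eq n by (cases "m = 0") auto
      then obtain k where k: "m = Suc k" by (cases m) auto
      define a b c where "a = coeff p (k + 3)" and "b = coeff p (k + 2)" and "c = coeff p (k + 1)"
      have "coeff q (k + 2) = (real k + 3) * a" "coeff q (k + 1) = (real k + 2) * b"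
        "coeff q k = (real k + 1) * c"
        by (simp_all add: q_def coeff_pderiv a_def b_def c_def eval_nat_numeral)
      then have "2 * (real k + 2) * ((real k + 3) * a * ((real k + 1) * c)) <
          (real k + 1) * ((real k + 2) * b)\<^sup>2"
        using strict_Newton_inequality[OF rq, of k] dq k by (simp add: add.commute)
      then have "(real k + 1) * (real k + 2) * (2 * (real k + 3) * (a * c)) <
          (real k + 1) * (real k + 2) * ((real k + 2) * b\<^sup>2)"
        by (simp add: power2_eq_square algebra_simps)
      then have "2 * (real k + 3) * (a * c) < (real k + 2) * b\<^sup>2"
        by (rule mult_left_less_imp_less) simp
      then show ?thesis
        by (simp add: k a_def b_def c_def eval_nat_numeral add_ac)
    qed
    ultimately show ?thesis
      using H_even_degree_pos_lead_coeff[of p m \<kappa>] assms(1) n \<kappa> by blast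
  qed
  then have H: "even (degree (H \<kappa> p))" "lead_coeff (H \<kappa> p) > 0"
    and root: "\<And>x. poly (H \<kappa> p) x = 0 \<Longrightarrow>
      poly (pderiv (H \<kappa> p)) x * (poly p x * poly q x) > 0"
    by blast+
  \<comment> \<open>By \<open>root\<close> the derivative of \<open>H\<close> is nonzero at every
    zero of \<open>H\<close>, so counting with multiplicity is counting distinct zeros.\<close>
  have "rsquarefree (H \<kappa> p)"
    unfolding rsquarefree_roots using root by fastforce
  then have "Z_R (H \<kappa> p) = card {x. poly (H \<kappa> p) x = 0}"
    by (simp add: Z_R_def size_proots_rsquarefree)
  moreover have "card {x. poly (H \<kappa> p) x = 0} + card {x. poly p x = 0} = degree p"
    using card_real_roots_H[OF sp, of \<kappa>] sq rq \<open>\<kappa> > 0\<close> root H unfolding q_def by blast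
  ultimately show ?thesis using Z_C_add_card_real_roots[OF sp] by linarith
qed

end
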